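(* Suppose the joint distribution of $(\tilde{\mathbf c},\tilde{\mathbf P})$ is finitely supported, with scenarios $s\in\mathcal S=\{1,\dots,n\}$, realizations $(\tilde{\mathbf c}^s,\tilde{\mathbf P}^s)$ and probabilities $p^1,\dots,p^n$. Consider the chance-constrained problem $$\text{(CCP)}\quad \min_{y\in\mathbb R,\ \boldsymbol\pi\in\Pi,\ \mathbf v}\ y\quad\text{s.t.}\quad \mathbb P_{\tilde{\mathbf c},\tilde{\mathbf P}}\Big(\sum_{i\in\mathcal H} q_i v_i^{(\tilde{\mathbf c},\tilde{\mathbf P})}\le y\Big)\ge\alpha,\qquad v_i^{(\tilde{\mathbf c},\tilde{\mathbf P})}=\tilde c_i(\pi_i)+\gamma\sum_{j\in\mathcal H}\tilde P_{ij}(\pi_i)\,v_j^{(\tilde{\mathbf c},\tilde{\mathbf P})}\quad (i\in\mathcal H),$$ where the policy $\boldsymbol\pi$ is the same for all realizations and $\mathbf v^{(\tilde{\mathbf c},\tilde{\mathbf P})}$ depends on the realization. Then (CCP) can be restated as the deterministic equivalent problem $$\text{(QMDP-R)}\quad \min\ y$$ over $y\in\mathbb R$, $w_{ia}$ ($i\in\mathcal H,a\in\mathcal A$), $v_i^s\in\mathbb R$ ($i\in\mathcal H$, $s\in\mathcal S$), $z^s$ ($s\in\mathcal S$), subject to $$\sum_{a\in\mathcal A}w_{ia}=1\ \ (i\in\mathcal H),\qquad \sum_{s\in\mathcal S}z^sp^s\ge\alpha,\qquad \sum_{i\in\mathcal H}q_iv_i^s\le y+(1-z^s)M\ \ (s\in\mathcal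 S),$$ $$v_i^s\ge\sum_{a\in\mathcal A}\tilde c_i^s(a)w_{ia}+\gamma\sum_{a\in\mathcal A}\sum_{j\in\mathcal H}\tilde P_{ij}^s(a)\,v_j^s\,w_{ia}\ \ (i\in\mathcal H,\ s\in\mathcal S),$$ $$z^s\in\{0,1\}\ (s\in\mathcal S),\qquad w_{ia}\in[0,1]\ (i\in\mathcal H,\ a\in\mathcal A),$$ where $M$ is a large number such that the constraint $\sum_{i}q_iv_i^s\le y+(1-z^s)M$ is redundant when $z^s=0$. That is, identifying a policy $\boldsymbol\pi\in\Pi$ with the array $\mathbf w$ in which $w_{ia}$ is the probability of taking action $a$ in state $i$, a pair $(y,\boldsymbol\pi)$ extends to a feasible solution of (CCP) if and only if $(y,\mathbf w)$ extends to a feasible solution of (QMDP-R); in particular the two problems have the same optimal value and the same optimal policies.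
   Context: An infinite-horizon discounted Markov decision process has a finite state space $\mathcal H$, a finite action space $\mathcal A$, discount factor $\gamma\in[0,1)$ and initial state distribution $\mathbf q=(q_i)_{i\in\mathcal H}$ (a probability vector). $\tilde c_i(a)$ is the immediate expected cost of action $a$ in state $i$, and $\tilde P_{ij}(a)$ is the probability of moving from $i$ to $j$ under action $a$ (so $\tilde P_{ij}(a)\ge 0$ and $\sum_j\tilde P_{ij}(a)=1$). All these parameters are nonnegative, stationary and bounded. The parameters $(\tilde{\mathbf c},\tilde{\mathbf P})$ are random; $\tilde{c}_i^s(a),\tilde P_{ij}^s(a)$ denote their values in scenario $s$, which has probability $p^s\geq 0$, $\sum_s p^s=1$. The confidence level is $\alpha\in(0,1]$. $\Pi$ is the set of stationary (randomized) Markov policies $\boldsymbol\pi=(\pi_i)_{i\in\mathcal H}$, where each $\pi_i=(w_{ia})_{a\in\mathcal A}$ is a probability distribution on $\mathcal A$. For such a policy, $\tilde c_i(\pi_i)=\sum_a w_{ia}\tilde c_i(a)$ and $\tilde P_{ij}(\pi_i)=\sum_a w_{ia}\tilde P_{ij}(a)$. For a policy $\boldsymbol\pi$ and scenario $s$, the Bellman equations $v_i=\tilde c^s_i(\pi_i)+\gamma\sum_j\tilde P^s_{ij}(\pi_i)v_j$ have a unique solution $\mathbf v$, and $C(\boldsymbol\pi,\tilde{\mathbf c}^s,\tilde{\mathbf P}^s)=\sum_i q_iv_i$ is the expected total discounted cost. Meaning of "$M$ makes the constraint redundant when $z^s=0$": $M$ is a real constant such that $C(\boldsymbol\pi,\tilde{\mathbf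 c}^s,\tilde{\mathbf P}^s)\le y+M$ for every $s\in\mathcal S$ and every $(y,\boldsymbol\pi)$, $\boldsymbol\pi\in\Pi$, that is feasible for (CCP), i.e. with $\sum_{s':\,C(\boldsymbol\pi,\tilde{\mathbf c}^{s'},\tilde{\mathbf P}^{s'})\le y}p^{s'}\ge\alpha$. *)

theory Defs
  imports "HOL-Probability.Probability_Mass_Function"
begin

text \<open>
  A realization of the random parameters is a pair \<open>(c, P)\<close>, where \<open>c i a\<close> is the
  immediate cost of action \<open>a\<close> in state \<open>i\<close> and \<open>P i j a\<close> is the probability of moving
  from \<open>i\<close> to \<open>j\<close> under \<open>a\<close>. A stationary randomized Markov policy assigns to each state a
  probability distribution on actions, so the set of all policies is the whole type
  \<open>('h, 'a) policy\<close>.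
\<close>

type_synonym ('h, 'a) params = "('h \<Rightarrow> 'a \<Rightarrow> real) \<times> ('h \<Rightarrow> 'h \<Rightarrow> 'a \<Rightarrow> real)"

type_synonym ('h, 'a) policy = "'h \<Rightarrow> 'a pmf"

definition policy_array :: "('h, 'a) policy \<Rightarrow> 'h \<Rightarrow> 'a \<Rightarrow> real" where
  "policy_array \<pi> i a = pmf (\<pi> i) a"

definition policy_cost :: "('h \<Rightarrow> 'a::finite \<Rightarrow> real) \<Rightarrow> ('h, 'a) policy \<Rightarrow> 'h \<Rightarrow> real" where
  "policy_cost c \<pi> i = (\<Sum>a\<in>UNIV. pmf (\<pi> i) a * c i a)"

definition policy_trans ::
    "('h \<Rightarrow> 'h \<Rightarrow> 'a::finite \<Rightarrow> real) \<Rightarrow> ('h, 'a) policy \<Rightarrow> 'h \<Rightarrow> 'h \<Rightarrow> real" where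
  "policy_trans P \<pi> i j = (\<Sum>a\<in>UNIV. pmf (\<pi> i) a * P i j a)"

definition bellman ::
    "real \<Rightarrow> ('h::finite, 'a::finite) params \<Rightarrow> ('h, 'a) policy \<Rightarrow> ('h \<Rightarrow> real) \<Rightarrow> bool" where
  "bellman \<gamma> \<xi> \<pi> v \<longleftrightarrow>
     (\<forall>i. v i = policy_cost (fst \<xi>) \<pi> i + \<gamma> * (\<Sum>j\<in>UNIV. policy_trans (snd \<xi>) \<pi> i j * v j))"

text \<open>
  For \<open>0 \<le> \<gamma> < 1\<close> and stochastic transition probabilities the solution of the Bellman
  equations exists and is unique, so the definite description is meaningful.
\<close>

definition total_cost ::
    "real \<Rightarrow> ('h::finite \<Rightarrow> real) \<Rightarrow> ('h, 'a::finite) policy \<Rightarrow> ('h, 'a) params \<Rightarrow> real" where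
  "total_cost \<gamma> q \<pi> \<xi> = (\<Sum>i\<in>UNIV. q i * (THE v. bellman \<gamma> \<xi> \<pi> v) i)"

text \<open>
  In the chance-constrained problem \<open>law\<close> is the joint distribution of \<open>(c, P)\<close>, and \<open>v\<close> is a
  function of the realization. The Bellman equations are imposed on the realizations of positive
  probability; the values of \<open>v\<close> elsewhere do not affect the chance constraint.
\<close>

definition ccp_feasible ::
    "('h::finite, 'a::finite) params pmf \<Rightarrow> real \<Rightarrow> ('h \<Rightarrow> real) \<Rightarrow> real \<Rightarrow>
     real \<Rightarrow> ('h, 'a) policy \<Rightarrow> (('h, 'a) params \<Rightarrow> 'h \<Rightarrow> real) \<Rightarrow> bool" where
  "ccp_feasible law \<gamma> q \<alpha> y \<pi> v \<longleftrightarrow>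
     measure_pmf.prob law {\<xi>. (\<Sum>i\<in>UNIV. q i * v \<xi> i) \<le> y} \<ge> \<alpha> \<and>
     (\<forall>\<xi>\<in>set_pmf law. bellman \<gamma> \<xi> \<pi> (v \<xi>))"

definition ccp_value ::
    "('h::finite, 'a::finite) params pmf \<Rightarrow> real \<Rightarrow> ('h \<Rightarrow> real) \<Rightarrow> real \<Rightarrow> ereal" where
  "ccp_value law \<gamma> q \<alpha> = Inf {ereal y | y \<pi> v. ccp_feasible law \<gamma> q \<alpha> y \<pi> v}"

definition ccp_optimal_policies ::
    "('h::finite, 'a::finite) params pmf \<Rightarrow> real \<Rightarrow> ('h \<Rightarrow> real) \<Rightarrow> real \<Rightarrow>
     ('h, 'a) policy set" where
  "ccp_optimal_policies law \<gamma> q \<alpha> =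
     {\<pi>. \<exists>y v. ccp_feasible law \<gamma> q \<alpha> y \<pi> v \<and>
          (\<forall>y' \<pi>' v'. ccp_feasible law \<gamma> q \<alpha> y' \<pi>' v' \<longrightarrow> y \<le> y')}"

text \<open>
  The deterministic equivalent has scenarios \<open>1, \<dots>, n\<close>; the values of the scenario-indexed
  functions outside \<open>{1..n}\<close> are irrelevant. Here \<open>w\<close> is an arbitrary real array.
\<close>

definition qmdpr_feasible ::
    "nat \<Rightarrow> (nat \<Rightarrow> real) \<Rightarrow> (nat \<Rightarrow> 'h::finite \<Rightarrow> 'a::finite \<Rightarrow> real) \<Rightarrow>
     (nat \<Rightarrow> 'h \<Rightarrow> 'h \<Rightarrow> 'a \<Rightarrow> real) \<Rightarrow> real \<Rightarrow> ('h \<Rightarrow> real) \<Rightarrow> real \<Rightarrow> real \<Rightarrow>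
     real \<Rightarrow> ('h \<Rightarrow> 'a \<Rightarrow> real) \<Rightarrow> (nat \<Rightarrow> 'h \<Rightarrow> real) \<Rightarrow> (nat \<Rightarrow> real) \<Rightarrow> bool" where
  "qmdpr_feasible n p c P \<gamma> q \<alpha> M y w v z \<longleftrightarrow>
     (\<forall>i. (\<Sum>a\<in>UNIV. w i a) = 1) \<and>
     (\<Sum>s=1..n. z s * p s) \<ge> \<alpha> \<and>
     (\<forall>s\<in>{1..n}. (\<Sum>i\<in>UNIV. q i * v s i) \<le> y + (1 - z s) * M) \<and>
     (\<forall>s\<in>{1..n}. \<forall>i. v s i \<ge> (\<Sum>a\<in>UNIV. c s i a * w i a)
        + \<gamma> * (\<Sum>a\<in>UNIV. \<Sum>j\<in>UNIV. P s i j a * v s j * w i a)) \<and>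
     (\<forall>s\<in>{1..n}. z s \<in> {0, 1}) \<and>
     (\<forall>i a. w i a \<in> {0..1})"

definition qmdpr_value ::
    "nat \<Rightarrow> (nat \<Rightarrow> real) \<Rightarrow> (nat \<Rightarrow> 'h::finite \<Rightarrow> 'a::finite \<Rightarrow> real) \<Rightarrow>
     (nat \<Rightarrow> 'h \<Rightarrow> 'h \<Rightarrow> 'a \<Rightarrow> real) \<Rightarrow> real \<Rightarrow> ('h \<Rightarrow> real) \<Rightarrow> real \<Rightarrow> real \<Rightarrow> ereal" where
  "qmdpr_value n p c P \<gamma> q \<alpha> M =
     Inf {ereal y | y w v z. qmdpr_feasible n p c P \<gamma> q \<alpha> M y w v z}"

definition qmdpr_optimal_arrays ::
    "nat \<Rightarrow> (nat \<Rightarrow> real) \<Rightarrow> (nat \<Rightarrow> 'h::finite \<Rightarrow> 'a::finite \<Rightarrow> real) \<Rightarrow>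
     (nat \<Rightarrow> 'h \<Rightarrow> 'h \<Rightarrow> 'a \<Rightarrow> real) \<Rightarrow> real \<Rightarrow> ('h \<Rightarrow> real) \<Rightarrow> real \<Rightarrow> real \<Rightarrow>
     ('h \<Rightarrow> 'a \<Rightarrow> real) set" where
  "qmdpr_optimal_arrays n p c P \<gamma> q \<alpha> M =
     {w. \<exists>y v z. qmdpr_feasible n p c P \<gamma> q \<alpha> M y w v z \<and>
          (\<forall>y' w' v' z'. qmdpr_feasible n p c P \<gamma> q \<alpha> M y' w' v' z' \<longrightarrow> y \<le> y')}"

text \<open>
  Redundancy of the cost constraint at \<open>z s = 0\<close>: for every \<open>(y, \<pi>)\<close> satisfying the chance
  constraint, written out over the scenarios, \<open>y + M\<close> bounds the cost in each scenario.
\<close>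

definition big_M ::
    "nat \<Rightarrow> (nat \<Rightarrow> real) \<Rightarrow> (nat \<Rightarrow> 'h::finite \<Rightarrow> 'a::finite \<Rightarrow> real) \<Rightarrow>
     (nat \<Rightarrow> 'h \<Rightarrow> 'h \<Rightarrow> 'a \<Rightarrow> real) \<Rightarrow> real \<Rightarrow> ('h \<Rightarrow> real) \<Rightarrow> real \<Rightarrow> real \<Rightarrow> bool" where
  "big_M n p c P \<gamma> q \<alpha> M \<longleftrightarrow>
     (\<forall>y \<pi>. (\<Sum>s' | s' \<in> {1..n} \<and> total_cost \<gamma> q \<pi> (c s', P s') \<le> y. p s') \<ge> \<alpha> \<longrightarrow>
        (\<forall>s\<in>{1..n}. total_cost \<gamma> q \<pi> (c s, P s) \<le> y + M))"

end

theory Submission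
  imports Defs
begin

text \<open>
  For a fixed policy the transition matrix is stochastic, so with a discount factor below one the
  Bellman operator obeys a comparison principle (\<open>discounted_comparison\<close>): every subsolution lies
  below every supersolution. Uniqueness of the Bellman solution is immediate from it, and existence
  follows because an injective linear map of a finite-dimensional space is surjective. Hence the
  Bellman inequality of the mixed-integer problem, together with \<open>q \<ge> 0\<close>, forces
  \<open>\<Sum>i. q i * v s i\<close> to be at least the true cost of scenario \<open>s\<close>, with equality attained by the
  Bellman solution itself; relaxing equation to inequality therefore loses nothing.

  After the values \<open>v\<close> are eliminated in this way, both problems say the same thing about
  \<open>(y, \<pi>)\<close>: the scenarios whose cost is at most \<open>y\<close> have total probability at least \<open>\<alpha>\<close>. In the
  chance-constrained problem this is the chance constraint, since the law is carried by the
  scenarios (\<open>ccp_feasible_iff\<close>). In the mixed-integer problem, a scenario with \<open>z s = 1\<close> must be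
  one of cost at most \<open>y\<close>; conversely \<open>z\<close> can be taken as the indicator of those scenarios,
  and the choice of \<open>M\<close> takes care of the others (\<open>qmdpr_feasible_iff\<close>). Equality of the
  optimal values and of the optimal policies is then formal, because the arrays admitted by the
  mixed-integer problem are exactly the arrays of policies.
\<close>

section \<open>Discounted linear systems with a stochastic matrix\<close>

text \<open>
  At a state maximizing \<open>u - v\<close> the two inequalities bound the maximum by \<open>\<gamma>\<close> times an average of
  \<open>u - v\<close>, hence by \<open>\<gamma>\<close> times itself; so it is not positive.
\<close>

lemma discounted_comparison:
  fixes A :: "'h::finite \<Rightarrow> 'h \<Rightarrow> real"
  assumes gamma: "0 \<le> \<gamma>" "\<gamma> < 1"
    and A_nonneg: "\<And>i j. A i j \<ge> 0"
    and A_sum: "\<And>i. (\<Sum>j\<in>UNIV. A i j) = 1"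
    and sub: "\<And>i. u i \<le> b i + \<gamma> * (\<Sum>j\<in>UNIV. A i j * u j)"
    and super: "\<And>i. v i \<ge> b i + \<gamma> * (\<Sum>j\<in>UNIV. A i j * v j)"
  shows "u i \<le> v i"
proof -
  define d where "d = Max (range (\<lambda>i. u i - v i))"
  have d_ge: "u j - v j \<le> d" for j
    unfolding d_def by (intro Max_ge) auto
  have "d \<in> range (\<lambda>i. u i - v i)"
    unfolding d_def by (intro Max_in) auto
  then obtain k where k: "d = u k - v k"
    by auto
  have "d \<le> \<gamma> * (\<Sum>j\<in>UNIV. A k j * u j) - \<gamma> * (\<Sum>j\<in>UNIV. A k j * v j)"
    using sub[of k] super[of k] k by linarith
  also have "\<dots> = \<gamma> * (\<Sum>j\<in>UNIV. A k j * (u j - v j))"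
    by (simp add: right_diff_distrib sum_subtractf)
  also have "\<dots> \<le> \<gamma> * (\<Sum>j\<in>UNIV. A k j * d)"
    by (intro mult_left_mono sum_mono d_ge gamma A_nonneg)
  also have "\<dots> = \<gamma> * d"
    by (simp add: A_sum flip: sum_distrib_right)
  finally have "(1 - \<gamma>) * d \<le> 0"
    by (simp add: algebra_simps)
  then have "d \<le> 0"
    using gamma by (simp add: mult_le_0_iff)
  then show ?thesis
    using d_ge[of i] by simp
qed

lemma discounted_system_unique:
  fixes A :: "'h::finite \<Rightarrow> 'h \<Rightarrow> real"
  assumes gamma: "0 \<le> \<gamma>" "\<gamma> < 1"
    and A_nonneg: "\<And>i j. A i j \<ge> 0"
    and A_sum: "\<And>i. (\<Sum>j\<in>UNIV. A i j) = 1"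
    and u: "\<And>i. u i = b i + \<gamma> * (\<Sum>j\<in>UNIV. A i j * u j)"
    and v: "\<And>i. v i = b i + \<gamma> * (\<Sum>j\<in>UNIV. A i j * v j)"
  shows "u = v"
proof (rule ext, rule antisym)
  fix i
  show "u i \<le> v i"
    using gamma A_nonneg A_sum u[THEN eq_refl] v[symmetric, THEN eq_refl]
    by (rule discounted_comparison)
  show "v i \<le> u i"
    using gamma A_nonneg A_sum v[THEN eq_refl] u[symmetric, THEN eq_refl]
    by (rule discounted_comparison)
qed

text \<open>
  Uniqueness for the homogeneous system says that \<open>I - \<gamma> A\<close> has trivial kernel.
\<close>

lemma discounted_system_solvable:
  fixes A :: "'h::finite \<Rightarrow> 'h \<Rightarrow> real"
  assumes gamma: "0 \<le> \<gamma>" "\<gamma> < 1"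
    and A_nonneg: "\<And>i j. A i j \<ge> 0"
    and A_sum: "\<And>i. (\<Sum>j\<in>UNIV. A i j) = 1"
  shows "\<exists>v. \<forall>i. v i = b i + \<gamma> * (\<Sum>j\<in>UNIV. A i j * v j)"
proof -
  define f :: "real ^ 'h \<Rightarrow> real ^ 'h"
    where "f x = (\<chi> i. x $ i - \<gamma> * (\<Sum>j\<in>UNIV. A i j * x $ j))" for x
  have f_nth: "f x $ i = x $ i - \<gamma> * (\<Sum>j\<in>UNIV. A i j * x $ j)" for x i
    by (simp add: f_def)
  have lin: "linear f"
  proof (rule linearI)
    show "f (x + y) = f x + f y" for x y
      unfolding f_def vec_eq_iff by (simp add: distrib_left sum.distrib)
    show "f (r *\<^sub>R x) = r *\<^sub>R f x" for r x
      unfolding f_def vec_eq_iff by (simp add: right_diff_distrib sum_distrib_left mult_ac)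
  qed
  have "x = 0" if "f x = 0" for x
  proof -
    have "($) x = (\<lambda>_. 0)"
    proof (rule discounted_system_unique[where b = "\<lambda>_. 0", OF gamma A_nonneg A_sum])
      show "x $ i = 0 + \<gamma> * (\<Sum>j\<in>UNIV. A i j * x $ j)" for i
        using f_nth[of x i] that by simp
    qed simp
    then show "x = 0"
      by (simp add: vec_eq_iff)
  qed
  then have "inj f"
    by (simp add: linear_injective_0[OF lin])
  then have "surj f"
    by (rule linear_inj_imp_surj[OF lin])
  then obtain x where x: "f x = (\<chi> i. b i)"
    using surjD[of f "\<chi> i. b i"] by force
  have "x $ i = b i + \<gamma> * (\<Sum>j\<in>UNIV. A i j * x $ j)" for i
    using f_nth[of x i] x by simp
  then show ?thesis
    by (intro exI[of _ "($) x"] allI)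
qed

section \<open>Bellman equations\<close>

lemma policy_trans_nonneg:
  assumes "\<And>i j a. P i j a \<ge> 0"
  shows "policy_trans P \<pi> i j \<ge> 0"
  using assms by (simp add: policy_trans_def sum_nonneg)

lemma policy_trans_sum:
  fixes \<pi> :: "('h::finite, 'a::finite) policy"
  assumes "\<And>i a. (\<Sum>j\<in>UNIV. P i j a) = 1"
  shows "(\<Sum>j\<in>UNIV. policy_trans P \<pi> i j) = 1"
proof -
  have "(\<Sum>j\<in>UNIV. policy_trans P \<pi> i j) = (\<Sum>a\<in>UNIV. pmf (\<pi> i) a * (\<Sum>j\<in>UNIV. P i j a))"
    unfolding policy_trans_def by (subst sum.swap) (simp add: sum_distrib_left)
  also have "\<dots> = 1"
    using assms by (simp add: sum_pmf_eq_1)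
  finally show ?thesis .
qed

lemma bellman_ex1:
  fixes \<pi> :: "('h::finite, 'a::finite) policy"
  assumes gamma: "0 \<le> \<gamma>" "\<gamma> < 1"
    and P_nonneg: "\<And>i j a. snd \<xi> i j a \<ge> 0"
    and P_sum: "\<And>i a. (\<Sum>j\<in>UNIV. snd \<xi> i j a) = 1"
  shows "\<exists>!v. bellman \<gamma> \<xi> \<pi> v"
proof -
  have nonneg: "policy_trans (snd \<xi>) \<pi> i j \<ge> 0" for i j
    using P_nonneg by (rule policy_trans_nonneg)
  have sum: "(\<Sum>j\<in>UNIV. policy_trans (snd \<xi>) \<pi> i j) = 1" for i
    using P_sum by (rule policy_trans_sum)
  show ?thesis
  proof (rule ex_ex1I)
    show "\<exists>v. bellman \<gamma> \<xi> \<pi> v"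
      unfolding bellman_def using gamma nonneg sum by (rule discounted_system_solvable)
    show "u = v" if "bellman \<gamma> \<xi> \<pi> u" "bellman \<gamma> \<xi> \<pi> v" for u v
      using gamma nonneg sum that[unfolded bellman_def, rule_format]
      by (rule discounted_system_unique)
  qed
qed

lemma bellman_the:
  assumes "\<exists>!v. bellman \<gamma> \<xi> \<pi> v"
  shows "bellman \<gamma> \<xi> \<pi> (THE v. bellman \<gamma> \<xi> \<pi> v)"
  using assms by (rule theI')

lemma total_cost_eq:
  assumes "\<exists>!v. bellman \<gamma> \<xi> \<pi> v" and "bellman \<gamma> \<xi> \<pi> v"
  shows "total_cost \<gamma> q \<pi> \<xi> = (\<Sum>i\<in>UNIV. q i * v i)"
  using the1_equality[OF assms(1)] assms by (simp add: total_cost_def)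

text \<open>
  The right-hand side of the value constraint in the mixed-integer problem is the Bellman operator,
  written with the sums over actions and successor states expanded.
\<close>

lemma bellman_operator_array:
  fixes \<pi> :: "('h::finite, 'a::finite) policy"
  shows "(\<Sum>a\<in>UNIV. c i a * policy_array \<pi> i a)
      + \<gamma> * (\<Sum>a\<in>UNIV. \<Sum>j\<in>UNIV. P i j a * v j * policy_array \<pi> i a)
    = policy_cost c \<pi> i + \<gamma> * (\<Sum>j\<in>UNIV. policy_trans P \<pi> i j * v j)"
proof -
  have "(\<Sum>a\<in>UNIV. \<Sum>j\<in>UNIV. P i j a * v j * policy_array \<pi> i a)
      = (\<Sum>j\<in>UNIV. policy_trans P \<pi> i j * v j)"
    by (subst sum.swap)
      (simp add: policy_trans_def policy_array_def sum_distrib_right sum_distrib_left mult_ac)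
  then show ?thesis
    by (simp add: policy_cost_def policy_array_def mult_ac)
qed

text \<open>
  Supersolutions of the Bellman equations overestimate the cost; this is what makes the Bellman
  inequality of the mixed-integer problem as good as the equation.
\<close>

lemma total_cost_le_supersolution:
  fixes \<pi> :: "('h::finite, 'a::finite) policy"
  assumes gamma: "0 \<le> \<gamma>" "\<gamma> < 1"
    and P_nonneg: "\<And>i j a. P i j a \<ge> 0"
    and P_sum: "\<And>i a. (\<Sum>j\<in>UNIV. P i j a) = 1"
    and q_nonneg: "\<And>i. q i \<ge> 0"
    and super: "\<And>i. v i \<ge> policy_cost c \<pi> i + \<gamma> * (\<Sum>j\<in>UNIV. policy_trans P \<pi> i j * v j)"
  shows "total_cost \<gamma> q \<pi> (c, P) \<le> (\<Sum>i\<in>UNIV. q i * v i)"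
proof -
  have ex1: "\<exists>!u. bellman \<gamma> (c, P) \<pi> u"
    by (rule bellman_ex1) (use gamma P_nonneg P_sum in simp_all)
  then obtain u where u: "bellman \<gamma> (c, P) \<pi> u"
    by blast
  then have solution: "u i = policy_cost c \<pi> i
      + \<gamma> * (\<Sum>j\<in>UNIV. policy_trans P \<pi> i j * u j)" for i
    unfolding bellman_def fst_conv snd_conv by (rule spec)
  have nonneg: "policy_trans P \<pi> i j \<ge> 0" for i j
    using P_nonneg by (rule policy_trans_nonneg)
  have sum: "(\<Sum>j\<in>UNIV. policy_trans P \<pi> i j) = 1" for i
    using P_sum by (rule policy_trans_sum)
  have "u i \<le> v i" for i
    using gamma nonneg sum solution[THEN eq_refl] super by (rule discounted_comparison)
  then show ?thesis
    unfolding total_cost_eq[OF ex1 u] by (intro sum_mono mult_left_mono q_nonneg)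
qed

section \<open>Policies as arrays\<close>

lemma policy_array_surj:
  fixes w :: "'h \<Rightarrow> 'a::finite \<Rightarrow> real"
  assumes w_sum: "\<And>i. (\<Sum>a\<in>UNIV. w i a) = 1" and w_range: "\<And>i a. w i a \<in> {0..1}"
  shows "w \<in> range policy_array"
proof
  have "pmf (embed_pmf (w i)) a = w i a" for i a
  proof (rule pmf_embed_pmf)
    show "(\<integral>\<^sup>+a. ennreal (w i a) \<partial>count_space UNIV) = 1"
      using w_sum w_range by (simp add: nn_integral_count_space_finite)
  qed (use w_range in simp)
  then show "w = policy_array (\<lambda>i. embed_pmf (w i))"
    by (simp add: policy_array_def fun_eq_iff)
qed simp

lemma policy_array_simplex:
  fixes \<pi> :: "('h, 'a::finite) policy"
  shows "(\<Sum>a\<in>UNIV. policy_array \<pi> i a) = 1" "policy_array \<pi> i a \<in> {0..1}"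
  by (simp_all add: policy_array_def sum_pmf_eq_1 pmf_le_1)

section \<open>Eliminating the value variables\<close>

text \<open>
  The values off the support of the law affect neither side. On the support they solve the
  Bellman equations, so that the event in the chance constraint is, up to a null set, the event
  that the total cost is at most \<open>y\<close>.
\<close>

lemma ccp_feasible_iff:
  fixes law :: "('h::finite, 'a::finite) params pmf"
  assumes ex1: "\<And>\<xi>. \<xi> \<in> set_pmf law \<Longrightarrow> \<exists>!v. bellman \<gamma> \<xi> \<pi> v"
  shows "(\<exists>v. ccp_feasible law \<gamma> q \<alpha> y \<pi> v) \<longleftrightarrow>
    measure_pmf.prob law {\<xi>. total_cost \<gamma> q \<pi> \<xi> \<le> y} \<ge> \<alpha>"
proof -
  have eq: "measure_pmf.prob law {\<xi>. (\<Sum>i\<in>UNIV. q i * v \<xi> i) \<le> y}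
      = measure_pmf.prob law {\<xi>. total_cost \<gamma> q \<pi> \<xi> \<le> y}"
    if "\<And>\<xi>. \<xi> \<in> set_pmf law \<Longrightarrow> bellman \<gamma> \<xi> \<pi> (v \<xi>)" for v
    by (rule measure_pmf.finite_measure_eq_AE)
      (use total_cost_eq[OF ex1 that] in \<open>auto simp: AE_measure_pmf_iff\<close>)
  show ?thesis
  proof
    assume "\<exists>v. ccp_feasible law \<gamma> q \<alpha> y \<pi> v"
    then show "measure_pmf.prob law {\<xi>. total_cost \<gamma> q \<pi> \<xi> \<le> y} \<ge> \<alpha>"
      using eq by (auto simp: ccp_feasible_def)
  next
    assume "measure_pmf.prob law {\<xi>. total_cost \<gamma> q \<pi> \<xi> \<le> y} \<ge> \<alpha>"
    then have "ccp_feasible law \<gamma> q \<alpha> y \<pi> (\<lambda>\<xi>. THE v. bellman \<gamma> \<xi> \<pi> v)"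
      using bellman_the[OF ex1] by (simp add: ccp_feasible_def total_cost_def)
    then show "\<exists>v. ccp_feasible law \<gamma> q \<alpha> y \<pi> v"
      by blast
  qed
qed

text \<open>
  From left to right only the scenarios with \<open>z s = 1\<close> matter: their values overestimate a cost
  that must not exceed \<open>y\<close>. From right to left the Bellman solutions and the indicator of the
  scenarios of cost at most \<open>y\<close> are feasible; redundancy of the constraints with \<open>z s = 0\<close>
  applies because \<open>(y, \<pi>)\<close> satisfies the chance constraint.
\<close>

lemma qmdpr_feasible_iff:
  fixes c :: "nat \<Rightarrow> 'h::finite \<Rightarrow> 'a::finite \<Rightarrow> real"
  assumes gamma: "0 \<le> \<gamma>" "\<gamma> < 1"
    and q_nonneg: "\<And>i. q i \<ge> 0"
    and p_nonneg: "\<And>s. s \<in> {1..n} \<Longrightarrow> p s \<ge> 0"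
    and P_nonneg: "\<And>s i j a. s \<in> {1..n} \<Longrightarrow> P s i j a \<ge> 0"
    and P_sum: "\<And>s i a. s \<in> {1..n} \<Longrightarrow> (\<Sum>j\<in>UNIV. P s i j a) = 1"
    and M: "big_M n p c P \<gamma> q \<alpha> M"
  shows "(\<exists>v z. qmdpr_feasible n p c P \<gamma> q \<alpha> M y (policy_array \<pi>) v z) \<longleftrightarrow>
    (\<Sum>s | s \<in> {1..n} \<and> total_cost \<gamma> q \<pi> (c s, P s) \<le> y. p s) \<ge> \<alpha>"
    (is "?feasible \<longleftrightarrow> ?chance")
proof
  assume ?feasible
  then obtain v z where "qmdpr_feasible n p c P \<gamma> q \<alpha> M y (policy_array \<pi>) v z"
    by blast
  then have z_sum: "(\<Sum>s=1..n. z s * p s) \<ge> \<alpha>"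
    and cost: "\<And>s. s \<in> {1..n} \<Longrightarrow> (\<Sum>i\<in>UNIV. q i * v s i) \<le> y + (1 - z s) * M"
    and super: "\<And>s i. s \<in> {1..n} \<Longrightarrow> v s i \<ge> policy_cost (c s) \<pi> i
        + \<gamma> * (\<Sum>j\<in>UNIV. policy_trans (P s) \<pi> i j * v s j)"
    and z_01: "\<And>s. s \<in> {1..n} \<Longrightarrow> z s \<in> {0, 1}"
    unfolding qmdpr_feasible_def bellman_operator_array by blast+
  have cheap: "total_cost \<gamma> q \<pi> (c s, P s) \<le> y" if s: "s \<in> {1..n}" "z s = 1" for s
  proof -
    have "total_cost \<gamma> q \<pi> (c s, P s) \<le> (\<Sum>i\<in>UNIV. q i * v s i)"
      using gamma P_nonneg[OF s(1)] P_sum[OF s(1)] q_nonneg super[OF s(1)]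
      by (rule total_cost_le_supersolution)
    then show ?thesis
      using cost[OF s(1)] s(2) by simp
  qed
  note z_sum
  also have "(\<Sum>s=1..n. z s * p s)
      \<le> (\<Sum>s=1..n. if total_cost \<gamma> q \<pi> (c s, P s) \<le> y then p s else 0)"
    using z_01 p_nonneg cheap by (intro sum_mono) fastforce
  also have "\<dots> = (\<Sum>s | s \<in> {1..n} \<and> total_cost \<gamma> q \<pi> (c s, P s) \<le> y. p s)"
    by (rule sum.inter_filter[symmetric]) simp
  finally show ?chance .
next
  assume chance: ?chance
  define v where "v s = (THE v. bellman \<gamma> (c s, P s) \<pi> v)" for s
  define z :: "nat \<Rightarrow> real" where "z s = of_bool (total_cost \<gamma> q \<pi> (c s, P s) \<le> y)" for s
  have v: "bellman \<gamma> (c s, P s) \<pi> (v s)" if "s \<in> {1..n}" for s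
    unfolding v_def by (intro bellman_the bellman_ex1) (use gamma P_nonneg P_sum that in simp_all)
  have super: "\<forall>s\<in>{1..n}. \<forall>i. v s i \<ge> policy_cost (c s) \<pi> i
      + \<gamma> * (\<Sum>j\<in>UNIV. policy_trans (P s) \<pi> i j * v s j)"
    using v unfolding bellman_def fst_conv snd_conv by (blast intro: eq_refl sym)
  have "(\<Sum>s=1..n. z s * p s) = (\<Sum>s=1..n. if total_cost \<gamma> q \<pi> (c s, P s) \<le> y then p s else 0)"
    by (intro sum.cong) (auto simp: z_def)
  also have "\<dots> = (\<Sum>s | s \<in> {1..n} \<and> total_cost \<gamma> q \<pi> (c s, P s) \<le> y. p s)"
    by (rule sum.inter_filter[symmetric]) simp
  finally have z_sum: "(\<Sum>s=1..n. z s * p s) \<ge> \<alpha>"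
    using chance by simp
  have cost: "\<forall>s\<in>{1..n}. (\<Sum>i\<in>UNIV. q i * v s i) \<le> y + (1 - z s) * M"
    using M chance by (auto simp: big_M_def z_def v_def simp flip: total_cost_def)
  have "qmdpr_feasible n p c P \<gamma> q \<alpha> M y (policy_array \<pi>) v z"
    unfolding qmdpr_feasible_def bellman_operator_array
    using policy_array_simplex[of \<pi>] super z_sum cost by (simp add: z_def)
  then show ?feasible
    by blast
qed

section \<open>The deterministic equivalent\<close>

theorem proposition1:
  fixes law :: "('h::finite, 'a::finite) params pmf"
    and n :: nat
    and p :: "nat \<Rightarrow> real"
    and c :: "nat \<Rightarrow> 'h \<Rightarrow> 'a \<Rightarrow> real"
    and P :: "nat \<Rightarrow> 'h \<Rightarrow> 'h \<Rightarrow> 'a \<Rightarrow> real"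
    and q :: "'h \<Rightarrow> real"
    and \<gamma> \<alpha> M :: real
  assumes gamma: "0 \<le> \<gamma>" "\<gamma> < 1"
    and alpha: "0 < \<alpha>" "\<alpha> \<le> 1"
    and q_nonneg: "\<And>i. q i \<ge> 0"
    and q_sum: "(\<Sum>i\<in>UNIV. q i) = 1"
    and p_nonneg: "\<And>s. s \<in> {1..n} \<Longrightarrow> p s \<ge> 0"
    and p_sum: "(\<Sum>s=1..n. p s) = 1"
    and c_nonneg: "\<And>s i a. s \<in> {1..n} \<Longrightarrow> c s i a \<ge> 0"
    and P_nonneg: "\<And>s i j a. s \<in> {1..n} \<Longrightarrow> P s i j a \<ge> 0"
    and P_sum: "\<And>s i a. s \<in> {1..n} \<Longrightarrow> (\<Sum>j\<in>UNIV. P s i j a) = 1"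
    and law: "\<And>X. measure_pmf.prob law X = (\<Sum>s | s \<in> {1..n} \<and> (c s, P s) \<in> X. p s)"
    and M: "big_M n p c P \<gamma> q \<alpha> M"
  shows "(\<forall>y \<pi>. (\<exists>v. ccp_feasible law \<gamma> q \<alpha> y \<pi> v) \<longleftrightarrow>
                 (\<exists>v z. qmdpr_feasible n p c P \<gamma> q \<alpha> M y (policy_array \<pi>) v z)) \<and>
         ccp_value law \<gamma> q \<alpha> = qmdpr_value n p c P \<gamma> q \<alpha> M \<and>
         policy_array ` ccp_optimal_policies law \<gamma> q \<alpha> = qmdpr_optimal_arrays n p c P \<gamma> q \<alpha> M"
proof -
  \<comment> \<open>A scenario of probability zero may lie outside the support, so this is only an inclusion.\<close>
  have supp: "\<exists>s\<in>{1..n}. \<xi> = (c s, P s)" if "\<xi> \<in> set_pmf law" for \<xi>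
  proof (rule ccontr)
    assume "\<not> ?thesis"
    then have "{s. s \<in> {1..n} \<and> (c s, P s) \<in> {\<xi>}} = {}"
      by auto
    then have "measure_pmf.prob law {\<xi>} = 0"
      unfolding law by (simp only: sum.empty)
    then show False
      using that by (simp add: measure_pmf_single set_pmf_iff)
  qed
  have ex1: "\<exists>!v. bellman \<gamma> \<xi> \<pi> v" if "\<xi> \<in> set_pmf law" for \<xi> \<pi>
    using supp[OF that] by (intro bellman_ex1) (use gamma P_nonneg P_sum in auto)
  have feasible_iff: "(\<exists>v. ccp_feasible law \<gamma> q \<alpha> y \<pi> v) \<longleftrightarrow>
      (\<exists>v z. qmdpr_feasible n p c P \<gamma> q \<alpha> M y (policy_array \<pi>) v z)" for y \<pi>
    using ccp_feasible_iff[of law \<gamma> \<pi> q \<alpha> y, OF ex1]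
      qmdpr_feasible_iff[of \<gamma> q n p P c \<alpha> M y \<pi>, OF gamma q_nonneg p_nonneg P_nonneg P_sum M]
    by (simp add: law)
  have array: "w \<in> range policy_array" if "qmdpr_feasible n p c P \<gamma> q \<alpha> M y w v z" for y w v z
    using that by (intro policy_array_surj) (auto simp: qmdpr_feasible_def)
  have objectives: "(\<exists>\<pi> v. ccp_feasible law \<gamma> q \<alpha> y \<pi> v) \<longleftrightarrow>
      (\<exists>w v z. qmdpr_feasible n p c P \<gamma> q \<alpha> M y w v z)" for y
    using feasible_iff array by (metis rangeE)
  have "{ereal y | y \<pi> v. ccp_feasible law \<gamma> q \<alpha> y \<pi> v}
      = {ereal y | y w v z. qmdpr_feasible n p c P \<gamma> q \<alpha> M y w v z}"
    using objectives by blast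
  then have "ccp_value law \<gamma> q \<alpha> = qmdpr_value n p c P \<gamma> q \<alpha> M"
    by (simp add: ccp_value_def qmdpr_value_def)
  moreover have optimal_iff: "\<pi> \<in> ccp_optimal_policies law \<gamma> q \<alpha> \<longleftrightarrow>
      policy_array \<pi> \<in> qmdpr_optimal_arrays n p c P \<gamma> q \<alpha> M" for \<pi>
    unfolding ccp_optimal_policies_def qmdpr_optimal_arrays_def mem_Collect_eq
    using feasible_iff objectives by metis
  have "qmdpr_optimal_arrays n p c P \<gamma> q \<alpha> M \<subseteq> range policy_array"
    using array by (auto simp: qmdpr_optimal_arrays_def)
  then have "policy_array ` ccp_optimal_policies law \<gamma> q \<alpha> = qmdpr_optimal_arrays n p c P \<gamma> q \<alpha> M"
    using optimal_iff by blast
  ultimately show ?thesis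
    using feasible_iff by blast
qed

end
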